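(* Let $c > 1$ be a real number and let $n \ge 0$ be an integer. Then all the coefficients of the Laurent polynomial $R_n(c; x) = T_n\left(\frac{c}{2}\left(x + \frac{1}{x}\right)\right)$ are non-negative. Indeed, the coefficients of $x^n, x^{n-2}, \ldots, x^{-n+2}, x^{-n}$ in $R_n(c;x)$ are positive, while all other coefficients are zero. The same is true of $S_n(c; x) = U_n\left(\frac{c}{2}\left(x + \frac{1}{x}\right)\right)$ in place of $R_n(c;x)$: the coefficients of $x^n, x^{n-2}, \ldots, x^{-n+2}, x^{-n}$ in $S_n(c;x)$ are positive, and all other coefficients are zero.
   Context: $T_n$ and $U_n$ denote the Chebyshev polynomials of the first and second kinds: $T_0(x)=1$, $T_1(x)=x$, $T_{n+1}(x) = 2xT_n(x) - T_{n-1}(x)$, and $U_0(x)=1$, $U_1(x)=2x$, $U_{n+1}(x)=2xU_n(x)-U_{n-1}(x)$. Equivalently, $T_n(\cos\theta)=\cos n\theta$ and $U_n(\cos\theta)=\sin((n+1)\theta)/\sin\theta$. $R_n(c;x)$ and $S_n(c;x)$ are regarded as Laurent polynomials in the single variable $x$ with real coefficients. *)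

theory Defs
  imports
    Complex_Main
    "HOL-Computational_Algebra.Polynomial"
    "HOL-Library.Poly_Mapping"
begin

fun cheb_T :: "nat \<Rightarrow> real poly" where
  "cheb_T 0 = 1"
| "cheb_T (Suc 0) = [:0, 1:]"
| "cheb_T (Suc (Suc n)) = 2 * [:0, 1:] * cheb_T (Suc n) - cheb_T n"

fun cheb_U :: "nat \<Rightarrow> real poly" where
  "cheb_U 0 = 1"
| "cheb_U (Suc 0) = [:0, 2:]"
| "cheb_U (Suc (Suc n)) = 2 * [:0, 1:] * cheb_U (Suc n) - cheb_U n"

text \<open>
  The ring of real Laurent polynomials in one variable is the group algebra of the integers:
  finitely supported functions from exponents to coefficients, with convolution as
  multiplication. The coefficient of the \<open>k\<close>-th power of the variable in \<open>p\<close> is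
  \<open>Poly_Mapping.lookup p k\<close>, and \<open>Poly_Mapping.single k a\<close> is the monomial with
  coefficient \<open>a\<close> and exponent \<open>k\<close>.
\<close>

type_synonym laurent_poly = "int \<Rightarrow>\<^sub>0 real"

definition lp_const :: "real \<Rightarrow> laurent_poly" where
  "lp_const a = Poly_Mapping.single 0 a"

definition lp_monom :: "int \<Rightarrow> laurent_poly" where
  "lp_monom k = Poly_Mapping.single k 1"

definition lp_coeff :: "laurent_poly \<Rightarrow> int \<Rightarrow> real" where
  "lp_coeff p k = Poly_Mapping.lookup p k"

definition lp_subst :: "real poly \<Rightarrow> laurent_poly \<Rightarrow> laurent_poly" where
  "lp_subst p q = poly (map_poly lp_const p) q"

definition cheb_R :: "nat \<Rightarrow> real \<Rightarrow> laurent_poly" where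
  "cheb_R n c = lp_subst (cheb_T n) (lp_const (c / 2) * (lp_monom 1 + lp_monom (-1)))"

definition cheb_S :: "nat \<Rightarrow> real \<Rightarrow> laurent_poly" where
  "cheb_S n c = lp_subst (cheb_U n) (lp_const (c / 2) * (lp_monom 1 + lp_monom (-1)))"

end

theory Submission
  imports Defs
begin

text \<open>
  Write \<open>s n k\<close> for the coefficient of \<open>x\<^sup>k\<close> in \<open>S\<^sub>n\<close>. The recurrence reads
  \<open>s (n+2) k = c (s (n+1) (k-1) + s (n+1) (k+1)) - s n k\<close>, so that
  \<open>s (n+2) k - s (n+1) (k-1) = (c-1) (s (n+1) (k-1) + s (n+1) (k+1)) + (s (n+1) (k+1) - s n k)\<close>,
  and symmetrically. Hence the inequalities \<open>s (n+1) k \<ge> s n (k-1)\<close> and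
  \<open>s (n+1) k \<ge> s n (k+1)\<close> propagate together with non-negativity; they give the
  positivity of \<open>S\<^sub>n\<close>. For \<open>R\<^sub>n\<close>, use \<open>2 T\<^sub>n\<^sub>+\<^sub>2 = U\<^sub>n\<^sub>+\<^sub>2 - U\<^sub>n\<close>: by the same inequalities, the
  coefficient \<open>s (n+2) k - s n k\<close> is at least \<open>(c-1) (s (n+1) (k-1) + s (n+1) (k+1))\<close>.
\<close>

text \<open>The shift is written \<open>- j + k\<close> because the exponent group is not assumed
  commutative.\<close>

lemma lookup_single_times:
  fixes p :: "'a::group_add \<Rightarrow>\<^sub>0 'b::semiring_0"
  shows "Poly_Mapping.lookup (Poly_Mapping.single j a * p) k = a * Poly_Mapping.lookup p (- j + k)"
proof -
  have "(k = j + q) = (q = - j + k)" for q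
    by (metis add.assoc add.right_inverse add.left_inverse add_0)
  then show ?thesis
    by (simp add: lookup_mult lookup_single when_mult)
qed

lemma lp_const_0 [simp]: "lp_const 0 = 0"
  and lp_const_1 [simp]: "lp_const 1 = 1"
  and lp_const_diff: "lp_const (a - b) = lp_const a - lp_const b"
  and lp_const_mult: "lp_const (a * b) = lp_const a * lp_const b"
  by (simp_all add: lp_const_def single_diff mult_single)

lemma lp_subst_0 [simp]: "lp_subst 0 q = 0"
  and lp_subst_1 [simp]: "lp_subst 1 q = 1"
  by (simp_all add: lp_subst_def map_poly_1')

lemma lp_subst_pCons [simp]: "lp_subst (pCons a p) q = lp_const a + q * lp_subst p q"
  by (simp add: lp_subst_def map_poly_pCons)

lemma lp_subst_diff: "lp_subst (p - p') q = lp_subst p q - lp_subst p' q"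
  by (induction p p' rule: poly_induct2) (simp_all add: lp_const_diff right_diff_distrib)

lemma lp_subst_smult: "lp_subst (smult a p) q = lp_const a * lp_subst p q"
  by (induction p) (simp_all add: lp_const_mult algebra_simps)

lemma lp_coeff_diff: "lp_coeff (p - q) k = lp_coeff p k - lp_coeff q k"
  by (simp add: lp_coeff_def lookup_minus)

lemma lp_coeff_const_mult: "lp_coeff (lp_const a * p) k = a * lp_coeff p k"
  by (simp add: lp_coeff_def lp_const_def lookup_single_times)

lemma lp_coeff_const: "lp_coeff (lp_const a) k = (if k = 0 then a else 0)"
  by (simp add: lp_coeff_def lp_const_def lookup_single when_def)

lemma lp_coeff_joukowski_mult:
  "lp_coeff (lp_const a * (lp_monom 1 + lp_monom (-1)) * p) k
     = a * (lp_coeff p (k - 1) + lp_coeff p (k + 1))"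
  by (simp add: lp_coeff_def lp_const_def lp_monom_def distrib_left[of "Poly_Mapping.single _ _"]
      distrib_right[of "Poly_Mapping.single _ _"] mult_single lookup_add lookup_single_times
      add.commute[of _ k] distrib_left[of a])

text \<open>Puts the leading term of the recurrence into the \<open>pCons\<close> and
  \<open>smult\<close> form on which \<open>lp_subst\<close> can be evaluated.\<close>

lemma two_mult_X: "2 * [:0, 1:] * p = pCons 0 (smult 2 (p :: real poly))"
  by (simp add: numeral_poly)

text \<open>Both sides obey the same linear recurrence and agree for the first two indices. In
  trigonometric form this is sin((n+3)t) - sin((n+1)t) = 2 cos((n+2)t) sin t.\<close>

lemma two_cheb_T: "smult 2 (cheb_T (Suc (Suc n))) = cheb_U (Suc (Suc n)) - cheb_U n"
proof (induction n rule: cheb_U.induct)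
  case (3 n)
  have "smult 2 (cheb_T (Suc (Suc (Suc (Suc n)))))
      = 2 * [:0, 1:] * smult 2 (cheb_T (Suc (Suc (Suc n)))) - smult 2 (cheb_T (Suc (Suc n)))"
    by (simp only: cheb_T.simps(3)[of "Suc (Suc n)"] smult_diff_right mult_smult_right)
  also have "\<dots> = cheb_U (Suc (Suc (Suc (Suc n)))) - cheb_U (Suc (Suc n))"
    unfolding 3 by (simp only: cheb_U.simps(3)[of "Suc (Suc n)"] cheb_U.simps(3)[of n] algebra_simps)
  finally show ?case .
qed (simp_all add: numeral_poly one_pCons)

lemma lp_coeff_cheb_S_0: "lp_coeff (cheb_S 0 c) k = (if k = 0 then 1 else 0)"
  using lp_coeff_const[of 1 k] by (simp add: cheb_S_def)

lemma lp_coeff_cheb_S_1: "lp_coeff (cheb_S (Suc 0) c) k = (if \<bar>k\<bar> = 1 then c else 0)"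
  by (auto simp: cheb_S_def lp_coeff_joukowski_mult lp_coeff_const)

lemma lp_coeff_cheb_S_Suc_Suc:
  "lp_coeff (cheb_S (Suc (Suc n)) c) k
     = c * (lp_coeff (cheb_S (Suc n) c) (k - 1) + lp_coeff (cheb_S (Suc n) c) (k + 1))
       - lp_coeff (cheb_S n c) k"
  by (simp add: cheb_S_def two_mult_X lp_subst_diff lp_subst_smult lp_coeff_diff
      lp_coeff_joukowski_mult lp_coeff_const_mult del: mult_pCons_left mult_pCons_right)

lemma lp_coeff_cheb_R_0: "lp_coeff (cheb_R 0 c) k = (if k = 0 then 1 else 0)"
  using lp_coeff_const[of 1 k] by (simp add: cheb_R_def)

lemma lp_coeff_cheb_R_1: "lp_coeff (cheb_R (Suc 0) c) k = (if \<bar>k\<bar> = 1 then c / 2 else 0)"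
  using lp_coeff_joukowski_mult[of "c / 2" 1 k] lp_coeff_const[of 1 "k - 1"] lp_coeff_const[of 1 "k + 1"]
  by (auto simp: cheb_R_def)

lemma lp_coeff_cheb_R_Suc_Suc:
  "2 * lp_coeff (cheb_R (Suc (Suc n)) c) k
     = lp_coeff (cheb_S (Suc (Suc n)) c) k - lp_coeff (cheb_S n c) k"
  unfolding cheb_R_def cheb_S_def
  by (metis lp_coeff_const_mult lp_coeff_diff lp_subst_diff lp_subst_smult two_cheb_T)

text \<open>A bound together with a parity condition is easy to follow when \<open>n\<close> and
  \<open>k\<close> change by one, which suits the inductions below.\<close>

lemma exponent_set_iff:
  "k \<in> {int n - 2 * int j | j. j \<le> n} \<longleftrightarrow> \<bar>k\<bar> \<le> int n \<and> even (int n - k)"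
proof
  assume k: "\<bar>k\<bar> \<le> int n \<and> even (int n - k)"
  then obtain m where "int n - k = 2 * m" by blast
  with k have "k = int n - 2 * int (nat m)" "nat m \<le> n" by auto
  then show "k \<in> {int n - 2 * int j | j. j \<le> n}" by blast
qed auto

lemma lp_coeff_cheb_S_eq_0:
  assumes "\<not> (\<bar>k\<bar> \<le> int n \<and> even (int n - k))"
  shows "lp_coeff (cheb_S n c) k = 0"
  using assms
proof (induction n arbitrary: k rule: cheb_U.induct)
  case (3 n)
  have "lp_coeff (cheb_S (Suc n) c) (k - 1) = 0"
    by (rule "3.IH"(1)) (use "3.prems" in \<open>auto simp: abs_le_iff\<close>)
  moreover have "lp_coeff (cheb_S (Suc n) c) (k + 1) = 0"
    by (rule "3.IH"(1)) (use "3.prems" in \<open>auto simp: abs_le_iff\<close>)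
  moreover have "lp_coeff (cheb_S n c) k = 0"
    by (rule "3.IH"(2)) (use "3.prems" in \<open>auto simp: abs_le_iff\<close>)
  ultimately show ?case
    by (simp add: lp_coeff_cheb_S_Suc_Suc)
qed (auto simp: lp_coeff_cheb_S_0 lp_coeff_cheb_S_1 abs_if split: if_splits)

lemma lp_coeff_cheb_S_mono:
  assumes "c \<ge> 1"
  shows "lp_coeff (cheb_S n c) k \<ge> 0"
    and "lp_coeff (cheb_S n c) k \<le> lp_coeff (cheb_S (Suc n) c) (k + 1)"
    and "lp_coeff (cheb_S n c) k \<le> lp_coeff (cheb_S (Suc n) c) (k - 1)"
proof -
  let ?s = "\<lambda>n. lp_coeff (cheb_S n c)"
  have "\<forall>k. 0 \<le> ?s n k \<and> ?s n k \<le> ?s (Suc n) (k + 1) \<and> ?s n k \<le> ?s (Suc n) (k - 1)"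
  proof (induction n)
    case 0
    show ?case using assms by (simp add: lp_coeff_cheb_S_0 lp_coeff_cheb_S_1)
  next
    case (Suc n)
    \<comment> \<open>Non-negativity is inherited along the chain \<open>?s (Suc n) k\<close> \<ge>
      \<open>?s n (k - 1)\<close> \<ge> 0.\<close>
    have nonneg: "0 \<le> ?s (Suc n) k" for k
      using Suc[rule_format, of "k - 1"] by simp
    have step: "?s (Suc n) (k - 1) \<le> ?s (Suc (Suc n)) k \<and> ?s (Suc n) (k + 1) \<le> ?s (Suc (Suc n)) k"
      for k
    proof -
      have "0 \<le> (c - 1) * (?s (Suc n) (k - 1) + ?s (Suc n) (k + 1))"
        using assms nonneg by (intro mult_nonneg_nonneg add_nonneg_nonneg) simp_all
      then show ?thesis
        using Suc[rule_format, of k] by (simp add: lp_coeff_cheb_S_Suc_Suc algebra_simps)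
    qed
    show ?case using nonneg step[of "_ + 1"] step[of "_ - 1"] by simp
  qed
  then show "?s n k \<ge> 0" "?s n k \<le> ?s (Suc n) (k + 1)" "?s n k \<le> ?s (Suc n) (k - 1)"
    by blast+
qed

text \<open>Each exponent of the support at \<open>Suc n\<close> has a neighbour, one step towards 0
  (or 1 if it is 0), in the support at \<open>n\<close>; monotonicity carries positivity over from
  there.\<close>

lemma lp_coeff_cheb_S_pos:
  assumes "c \<ge> 1" "\<bar>k\<bar> \<le> int n" "even (int n - k)"
  shows "lp_coeff (cheb_S n c) k > 0"
  using assms(2,3)
proof (induction n arbitrary: k)
  case 0
  then show ?case by (simp add: lp_coeff_cheb_S_0)
next
  case (Suc n)
  show ?case
  proof (cases "k > 0")
    case True
    then have "0 < lp_coeff (cheb_S n c) (k - 1)"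
      using Suc.prems by (intro Suc.IH) auto
    then show ?thesis
      using lp_coeff_cheb_S_mono(2)[OF assms(1), of n "k - 1"] by simp
  next
    case False
    \<comment> \<open>This follows from parity. For \<open>n = 0\<close> it excludes
      \<open>k = 0\<close>, whose neighbour 1 would lie outside the support.\<close>
    moreover have "k \<noteq> - int n" using Suc.prems(2) by auto
    ultimately have "0 < lp_coeff (cheb_S n c) (k + 1)"
      using Suc.prems by (intro Suc.IH) (auto simp: abs_le_iff)
    then show ?thesis
      using lp_coeff_cheb_S_mono(3)[OF assms(1), of n "k + 1"] by simp
  qed
qed

text \<open>Strictness of \<open>c > 1\<close> matters here: for \<open>c = 1\<close> the Laurent
  polynomial is \<open>(x^n + x^(-n)) / 2\<close>, and its inner coefficients vanish.\<close>

lemma lp_coeff_cheb_R_pos: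
  assumes "c > 1" "\<bar>k\<bar> \<le> int n" "even (int n - k)"
  shows "lp_coeff (cheb_R n c) k > 0"
  using assms(2,3)
proof (induction n rule: cheb_T.induct)
  case (3 n)
  let ?s = "\<lambda>n. lp_coeff (cheb_S n c)"
  have c: "c \<ge> 1" using assms(1) by simp
  have "0 < ?s (Suc n) (k - 1) \<or> 0 < ?s (Suc n) (k + 1)"
  proof (cases "k > 0")
    case True
    then show ?thesis
      using "3.prems" by (intro disjI1 lp_coeff_cheb_S_pos[OF c]) auto
  next
    case False
    then show ?thesis
      using "3.prems" by (intro disjI2 lp_coeff_cheb_S_pos[OF c]) auto
  qed
  then have "0 < ?s (Suc n) (k - 1) + ?s (Suc n) (k + 1)"
    using lp_coeff_cheb_S_mono(1)[OF c, of "Suc n"] by (meson add_nonneg_pos add_pos_nonneg)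
  then have "0 < (c - 1) * (?s (Suc n) (k - 1) + ?s (Suc n) (k + 1))"
    using assms(1) by simp
  \<comment> \<open>With a and b the coefficients of \<open>cheb_S (Suc n) c\<close> at
    \<open>k - 1\<close> and \<open>k + 1\<close>, and d that of \<open>cheb_S n c\<close> at
    \<open>k\<close>, the right side equals (c-1)(a+b) + (a-d) + (b-d).\<close>
  then have "0 < 2 * lp_coeff (cheb_R (Suc (Suc n)) c) k"
    using lp_coeff_cheb_S_mono(2,3)[OF c, of n k]
    unfolding lp_coeff_cheb_R_Suc_Suc lp_coeff_cheb_S_Suc_Suc by (simp add: algebra_simps)
  then show ?case by simp
next
  case 2
  then have "\<bar>k\<bar> = 1" by (cases "k = 0") auto
  then show ?case using assms(1) by (simp add: lp_coeff_cheb_R_1)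
qed (simp add: lp_coeff_cheb_R_0)

lemma lp_coeff_cheb_R_eq_0:
  assumes "\<not> (\<bar>k\<bar> \<le> int n \<and> even (int n - k))"
  shows "lp_coeff (cheb_R n c) k = 0"
  using assms
proof (induction n rule: cheb_T.induct)
  case (3 n)
  have "lp_coeff (cheb_S (Suc (Suc n)) c) k = 0"
    by (rule lp_coeff_cheb_S_eq_0) (use "3.prems" in auto)
  moreover have "lp_coeff (cheb_S n c) k = 0"
    by (rule lp_coeff_cheb_S_eq_0) (use "3.prems" in auto)
  ultimately show ?case using lp_coeff_cheb_R_Suc_Suc[of n c k] by simp
qed (auto simp: lp_coeff_cheb_R_0 lp_coeff_cheb_R_1 abs_if split: if_splits)

theorem theorem2p1:
  fixes c :: real and n :: nat
  assumes "c > 1"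
  shows "(\<forall>k. lp_coeff (cheb_R n c) k \<ge> 0)
       \<and> (\<forall>k \<in> {int n - 2 * int j | j. j \<le> n}. lp_coeff (cheb_R n c) k > 0)
       \<and> (\<forall>k. k \<notin> {int n - 2 * int j | j. j \<le> n} \<longrightarrow> lp_coeff (cheb_R n c) k = 0)
       \<and> (\<forall>k. lp_coeff (cheb_S n c) k \<ge> 0)
       \<and> (\<forall>k \<in> {int n - 2 * int j | j. j \<le> n}. lp_coeff (cheb_S n c) k > 0)
       \<and> (\<forall>k. k \<notin> {int n - 2 * int j | j. j \<le> n} \<longrightarrow> lp_coeff (cheb_S n c) k = 0)"
proof -
  have c: "c \<ge> 1" using assms by simp
  have "lp_coeff (cheb_R n c) k \<ge> 0" for k
    using lp_coeff_cheb_R_pos[OF assms, of k n] lp_coeff_cheb_R_eq_0[of k n c] by fastforce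
  then show ?thesis
    unfolding exponent_set_iff Ball_def
    using lp_coeff_cheb_R_pos[OF assms] lp_coeff_cheb_R_eq_0
      lp_coeff_cheb_S_mono(1)[OF c] lp_coeff_cheb_S_pos[OF c] lp_coeff_cheb_S_eq_0
    by blast
qed

end
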